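(* Let $(X,\mathcal{B},\mu)$ be a $\sigma$-finite measure space and let $T:X\to X$ be a conservative, measure preserving transformation. Let $f,g\in L^1(X,\mu)$ be real-valued, with $g>0$ $\mu$-almost everywhere. Then the limit $$h:=\lim_{n\to\infty}\frac{S_n f}{S_n g}$$ exists $\mu$-almost everywhere. The function $h$ is finite $\mu$-almost everywhere, $T$-invariant (that is, $h\circ T=h$ $\mu$-almost everywhere), and for every $T$-invariant set $A\in\mathcal{B}$, $$\int_A f\,d\mu=\int_A h\,g\,d\mu .$$
   Context: A measure preserving transformation $T$ of $(X,\mathcal{B},\mu)$ is conservative if for every $A\in\mathcal{B}$ with $\mu(A)>0$ there exists $n\geq 1$ such that $\mu(A\cap T^{-n}A)>0$. Ergodicity is not assumed. A subset $A\subset X$ is $T$-invariant if $T^{-1}A=A$. For $f:X\to\mathbb{R}$, $S_n f:=\sum_{k=0}^{n-1} f\circ T^k$ denotes the Birkhoff sums. *)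

theory Defs
  imports "HOL-Analysis.Analysis"
begin

definition measure_preserving_map :: "'a measure \<Rightarrow> ('a \<Rightarrow> 'a) \<Rightarrow> bool" where
  "measure_preserving_map M T \<longleftrightarrow>
     T \<in> measurable M M \<and>
     (\<forall>A\<in>sets M. emeasure M (T -` A \<inter> space M) = emeasure M A)"

definition conservative_map :: "'a measure \<Rightarrow> ('a \<Rightarrow> 'a) \<Rightarrow> bool" where
  "conservative_map M T \<longleftrightarrow>
     (\<forall>A\<in>sets M. emeasure M A > 0 \<longrightarrow>
        (\<exists>n\<ge>1. emeasure M (A \<inter> ((T ^^ n) -` A \<inter> space M)) > 0))"

text \<open>Preimages are taken within the space of the measure, so invariance of a set forces
  it to be a subset of that space.\<close>

definition invariant_set :: "'a measure \<Rightarrow> ('a \<Rightarrow> 'a) \<Rightarrow> 'a set \<Rightarrow> bool" where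
  "invariant_set M T A \<longleftrightarrow> T -` A \<inter> space M = A"

definition birkhoff_sum :: "('a \<Rightarrow> 'a) \<Rightarrow> nat \<Rightarrow> ('a \<Rightarrow> real) \<Rightarrow> 'a \<Rightarrow> real" where
  "birkhoff_sum T n f x = (\<Sum>k<n. f ((T ^^ k) x))"

end

theory Submission
  imports Defs
begin

text \<open>This is Hopf's ratio ergodic theorem. Write \<open>S n\<close> for Birkhoff sums. Two facts drive
  the proof.

  The first is recurrence. The points of a set \<open>A\<close> that never return to \<open>A\<close> form a wandering
  set, so conservativity makes it null. Almost every orbit therefore visits some set where \<open>g\<close> is
  bounded away from \<open>0\<close> infinitely often, and \<open>S n g\<close> tends to infinity almost everywhere
  (\<open>birkhoff_sum_at_top\<close>). Hence ratios of Birkhoff sums forget any finite initial part of the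
  orbit.

  The second is the maximal inequality (\<open>maximal_ergodic_inequality\<close>): the integral of \<open>\<phi>\<close> over
  the set where some \<open>S n \<phi>\<close> is positive is nonnegative. Localised to an invariant set \<open>A\<close>, it
  says that the integral of \<open>\<phi>\<close> over \<open>A\<close> is nonnegative as soon as almost every point of \<open>A\<close>
  has a positive Birkhoff sum (\<open>integral_nonneg_on_invariant_set\<close>).

  \<^emph>\<open>Convergence.\<close> If the ratios oscillate across a rational interval from \<open>a\<close> to \<open>b\<close> at \<open>x\<close>,
  then both \<open>S n (f - b g)\<close> and \<open>S n (a g - f)\<close> are unbounded above at \<open>x\<close>. Unboundedness
  above, unlike positivity of a supremum, is unchanged when \<open>x\<close> is replaced by \<open>T x\<close>, so these
  conditions define an invariant set, on which both \<open>f - b g\<close> and \<open>a g - f\<close> have nonnegative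
  integral. Adding up, \<open>(a - b) \<integral> g \<ge> 0\<close>, and since \<open>g > 0\<close> the set is null
  (\<open>AE_not_oscillating\<close>). The same argument shows that the ratios are almost everywhere bounded
  (\<open>AE_ratio_bounded_above\<close>).

  \<^emph>\<open>The integral.\<close> If \<open>S n \<phi> / S n g\<close> has a nonnegative lower limit almost everywhere, then
  \<open>\<phi> + e g\<close> has a positive Birkhoff sum for every \<open>e > 0\<close>, so the integral of \<open>\<phi>\<close> over each
  invariant set is nonnegative (\<open>integral_nonneg_if_ratio_nonneg\<close>). Since the limit \<open>h\<close> is invariant,
  the ratio for \<open>f - h g\<close> tends to \<open>0\<close>, and applying this to both signs of \<open>f - h g\<close> gives the
  identity. Integrability of \<open>h g\<close> comes from the same criterion applied to \<open>\<bar>f\<bar> - (min \<bar>h\<bar> K) g\<close>,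
  followed by monotone convergence in \<open>K\<close>.\<close>

section \<open>Birkhoff sums\<close>

lemma birkhoff_sum_Suc:
  "birkhoff_sum T (Suc n) \<phi> x = \<phi> x + birkhoff_sum T n \<phi> (T x)"
  unfolding birkhoff_sum_def by (simp add: sum.lessThan_Suc_shift funpow_swap1 del: sum.lessThan_Suc)

lemma birkhoff_sum_add:
  "birkhoff_sum T n (\<lambda>x. \<phi> x + \<psi> x) x = birkhoff_sum T n \<phi> x + birkhoff_sum T n \<psi> x"
  by (simp add: birkhoff_sum_def sum.distrib)

lemma birkhoff_sum_diff:
  "birkhoff_sum T n (\<lambda>x. \<phi> x - \<psi> x) x = birkhoff_sum T n \<phi> x - birkhoff_sum T n \<psi> x"
  by (simp add: birkhoff_sum_def sum_subtractf)

lemma birkhoff_sum_cmult: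
  "birkhoff_sum T n (\<lambda>x. c * \<phi> x) x = c * birkhoff_sum T n \<phi> x"
  by (simp add: birkhoff_sum_def sum_distrib_left)

lemma birkhoff_sum_invariant_mult:
  assumes "\<And>k. u ((T ^^ k) x) = u x"
  shows "birkhoff_sum T n (\<lambda>y. u y * \<phi> y) x = u x * birkhoff_sum T n \<phi> x"
  by (simp add: birkhoff_sum_def sum_distrib_left assms)

lemma abs_birkhoff_sum_le: "\<bar>birkhoff_sum T n \<phi> x\<bar> \<le> birkhoff_sum T n (\<lambda>x. \<bar>\<phi> x\<bar>) x"
  by (simp add: birkhoff_sum_def)

text \<open>The bound ranges over the natural numbers so that measurability is immediate.\<close>

definition unbounded_sums :: "'a measure \<Rightarrow> ('a \<Rightarrow> 'a) \<Rightarrow> ('a \<Rightarrow> real) \<Rightarrow> 'a set" where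
  "unbounded_sums M T \<phi> = {x \<in> space M. \<forall>K::nat. \<exists>n. birkhoff_sum T n \<phi> x > real K}"

lemma unbounded_sumsD:
  assumes "x \<in> unbounded_sums M T \<phi>"
  shows "\<exists>n. birkhoff_sum T n \<phi> x > K"
proof -
  obtain k :: nat where "K \<le> real k" using real_arch_simple by blast
  moreover obtain n where "birkhoff_sum T n \<phi> x > real k"
    using assms by (auto simp: unbounded_sums_def)
  ultimately show ?thesis by (intro exI[of _ n]) simp
qed

section \<open>Measure preserving maps\<close>

lemma measure_preserving_measurable:
  "measure_preserving_map M T \<Longrightarrow> T \<in> measurable M M"
  by (simp add: measure_preserving_map_def)

text \<open>The form of measure preservation in which the library's change of variables applies.\<close>

lemma measure_preserving_distr:
  assumes "measure_preserving_map M T"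
  shows "distr M M T = M"
  using assms by (intro measure_eqI) (auto simp: measure_preserving_map_def emeasure_distr)

lemma measure_preserving_AE:
  assumes T: "measure_preserving_map M T" and P: "AE x in M. P x"
  shows "AE x in M. P (T x)"
proof (rule AE_distrD[OF measure_preserving_measurable[OF T]])
  show "AE x in distr M M T. P x" unfolding measure_preserving_distr[OF T] by (rule P)
qed

lemma measure_preserving_AE_orbit:
  assumes T: "measure_preserving_map M T" and P: "AE x in M. P x"
  shows "AE x in M. \<forall>n. P ((T ^^ n) x)"
proof -
  have "AE x in M. P ((T ^^ n) x)" for n
  proof (induction n)
    case (Suc n)
    show ?case using measure_preserving_AE[OF T Suc] by (simp add: funpow_swap1)
  qed (use P in simp)
  then show ?thesis by (simp add: AE_all_countable)
qed

lemma measure_preserving_integral: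
  fixes \<phi> :: "'a \<Rightarrow> real"
  assumes T: "measure_preserving_map M T" and \<phi>: "integrable M \<phi>"
  shows "integrable M (\<lambda>x. \<phi> (T x))" "(LINT x|M. \<phi> (T x)) = (LINT x|M. \<phi> x)"
proof -
  note [measurable] = measure_preserving_measurable[OF T] borel_measurable_integrable[OF \<phi>]
  show "integrable M (\<lambda>x. \<phi> (T x))"
    using integrable_distr[OF measure_preserving_measurable[OF T], of \<phi>] \<phi>
    by (simp add: measure_preserving_distr[OF T])
  show "(LINT x|M. \<phi> (T x)) = (LINT x|M. \<phi> x)"
    using integral_distr[of T M M \<phi>] by (simp add: measure_preserving_distr[OF T])
qed

lemma birkhoff_sum_measurable:
  fixes \<phi> :: "'a \<Rightarrow> real"
  assumes [measurable]: "T \<in> measurable M M" "\<phi> \<in> borel_measurable M"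
  shows "birkhoff_sum T n \<phi> \<in> borel_measurable M"
proof -
  have [measurable]: "(T ^^ k) \<in> measurable M M" for k
    by (rule measurable_compose_n) simp
  show ?thesis unfolding birkhoff_sum_def by measurable
qed

lemma unbounded_sums_sets:
  assumes [measurable]: "T \<in> measurable M M" "\<phi> \<in> borel_measurable M"
  shows "unbounded_sums M T \<phi> \<in> sets M"
proof -
  note [measurable] = birkhoff_sum_measurable[OF assms]
  show ?thesis unfolding unbounded_sums_def by measurable
qed

text \<open>Passing from \<open>x\<close> to \<open>T x\<close> shifts the sequence of sums by one index and subtracts the constant \<open>\<phi> x\<close>.\<close>

lemma unbounded_sums_shift:
  "(\<forall>K::nat. \<exists>n. birkhoff_sum T n \<phi> (T x) > real K) \<longleftrightarrow>
   (\<forall>K::nat. \<exists>n. birkhoff_sum T n \<phi> x > real K)"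
proof (intro iffI allI)
  fix K :: nat
  assume *: "\<forall>K::nat. \<exists>n. birkhoff_sum T n \<phi> (T x) > real K"
  obtain k :: nat where k: "real K - \<phi> x \<le> real k" using real_arch_simple by blast
  from * obtain n where "birkhoff_sum T n \<phi> (T x) > real k" by blast
  with k have "birkhoff_sum T (Suc n) \<phi> x > real K" by (simp add: birkhoff_sum_Suc)
  then show "\<exists>n. birkhoff_sum T n \<phi> x > real K" by blast
next
  fix K :: nat
  assume *: "\<forall>K::nat. \<exists>n. birkhoff_sum T n \<phi> x > real K"
  obtain k :: nat where k: "real K + \<bar>\<phi> x\<bar> \<le> real k" using real_arch_simple by blast
  from * obtain n where n: "birkhoff_sum T n \<phi> x > real k" by blast
  with k have "n \<noteq> 0" by (intro notI) (simp add: birkhoff_sum_def)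
  then obtain m where "n = Suc m" by (cases n) auto
  with n k have "birkhoff_sum T m \<phi> (T x) > real K" by (simp add: birkhoff_sum_Suc)
  then show "\<exists>n. birkhoff_sum T n \<phi> (T x) > real K" by blast
qed

lemma unbounded_sums_invariant:
  assumes "T \<in> measurable M M"
  shows "invariant_set M T (unbounded_sums M T \<phi>)"
  using measurable_space[OF assms]
  by (auto simp: invariant_set_def unbounded_sums_def unbounded_sums_shift)

lemma invariant_set_Int:
  "invariant_set M T A \<Longrightarrow> invariant_set M T B \<Longrightarrow> invariant_set M T (A \<inter> B)"
  by (auto simp: invariant_set_def)

lemma invariant_set_INT:
  assumes "\<And>i::nat. invariant_set M T (A i)"
  shows "invariant_set M T (\<Inter>i. A i)"
proof -
  have "x \<in> A i \<longleftrightarrow> T x \<in> A i \<and> x \<in> space M" for x i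
    using assms[of i] unfolding invariant_set_def by blast
  then show ?thesis unfolding invariant_set_def by blast
qed

lemma invariant_set_orbit:
  assumes A: "invariant_set M T A" and T: "T \<in> measurable M M" and x: "x \<in> space M"
  shows "(T ^^ k) x \<in> A \<longleftrightarrow> x \<in> A"
  using x
proof (induction k arbitrary: x)
  case (Suc k)
  have "T x \<in> space M" using measurable_space[OF T Suc.prems] .
  then have "(T ^^ Suc k) x \<in> A \<longleftrightarrow> T x \<in> A" using Suc.IH by (simp add: funpow_swap1)
  also have "\<dots> \<longleftrightarrow> x \<in> A" using A Suc.prems by (auto simp: invariant_set_def)
  finally show ?case .
qed simp

lemma set_integrable_if_integrable:
  fixes \<phi> :: "'a \<Rightarrow> real"
  assumes "integrable M \<phi>" "A \<in> sets M"
  shows "set_integrable M A \<phi>"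
  unfolding set_integrable_def by (rule integrable_mult_indicator[OF assms(2,1)])

section \<open>The maximal inequality\<close>

text \<open>This is the maximum of the Birkhoff sums of lengths \<open>0, \<dots>, N\<close>. The recursive form is the
  identity on which the maximal inequality rests, and it makes integrability and
  monotonicity in \<open>N\<close> plain inductions.\<close>

primrec max_sum :: "('a \<Rightarrow> 'a) \<Rightarrow> nat \<Rightarrow> ('a \<Rightarrow> real) \<Rightarrow> 'a \<Rightarrow> real" where
  "max_sum T 0 \<phi> x = 0"
| "max_sum T (Suc N) \<phi> x = max 0 (\<phi> x + max_sum T N \<phi> (T x))"

lemma max_sum_mono_Suc: "max_sum T N \<phi> x \<le> max_sum T (Suc N) \<phi> x"
proof (induction N arbitrary: x)
  case (Suc N)
  show ?case using Suc.IH[of "T x"] by (simp add: max.coboundedI2)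
qed simp

lemma birkhoff_sum_le_max_sum: "birkhoff_sum T n \<phi> x \<le> max_sum T n \<phi> x"
proof (induction n arbitrary: x)
  case (Suc n)
  show ?case using Suc.IH[of "T x"] by (simp add: birkhoff_sum_Suc max.coboundedI2)
qed (simp add: birkhoff_sum_def)

lemma max_sum_attained: "\<exists>n. max_sum T N \<phi> x = birkhoff_sum T n \<phi> x"
proof (induction N arbitrary: x)
  case 0
  show ?case by (intro exI[of _ 0]) (simp add: birkhoff_sum_def)
next
  case (Suc N)
  obtain n where n: "max_sum T N \<phi> (T x) = birkhoff_sum T n \<phi> (T x)" using Suc.IH by blast
  have "max_sum T (Suc N) \<phi> x = birkhoff_sum T 0 \<phi> x \<or>
        max_sum T (Suc N) \<phi> x = birkhoff_sum T (Suc n) \<phi> x"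
    using n by (auto simp: birkhoff_sum_Suc birkhoff_sum_def[of T 0] max_def)
  then show ?case by blast
qed

lemma max_sum_integrable:
  assumes T: "measure_preserving_map M T" and \<phi>: "integrable M \<phi>"
  shows "integrable M (max_sum T N \<phi>)"
proof (induction N)
  case (Suc N)
  show ?case
    using \<phi> measure_preserving_integral(1)[OF T Suc] by (simp add: integrable_max)
qed simp

text \<open>Garsia's argument. Let \<open>F N\<close> be the maximum of the Birkhoff sums of length at most \<open>N\<close>. Where
  \<open>F (N + 1)\<close> is positive, \<open>\<phi> = F (N + 1) - F N \<circ> T\<close>; elsewhere \<open>F (N + 1) - F N \<circ> T \<le> 0\<close>. So the
  integral of \<open>\<phi>\<close> over \<open>{F (N + 1) > 0}\<close> is at least \<open>\<integral> F (N + 1) - \<integral> F N \<circ> T\<close>, which by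
  invariance of the measure is \<open>\<integral> F (N + 1) - \<integral> F N \<ge> 0\<close>. These sets increase to the
  set in question.\<close>

lemma maximal_ergodic_inequality:
  assumes T: "measure_preserving_map M T" and \<phi>: "integrable M \<phi>"
  shows "0 \<le> (LINT x:{x \<in> space M. \<exists>n. birkhoff_sum T n \<phi> x > 0}|M. \<phi> x)"
proof -
  let ?E = "\<lambda>N. {x \<in> space M. max_sum T N \<phi> x > 0}"
  note int = max_sum_integrable[OF T \<phi>]
  note [measurable] = borel_measurable_integrable[OF int] borel_measurable_integrable[OF \<phi>]
  have E: "?E N \<in> sets M" for N by measurable
  \<comment> \<open>The index starts at one: the recursion describes only the maxima with successor index.\<close>
  have nonneg: "0 \<le> (LINT x:?E (Suc N)|M. \<phi> x)" for N
  proof -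
    have "0 \<le> (LINT x|M. max_sum T (Suc N) \<phi> x) - (LINT x|M. max_sum T N \<phi> x)"
      using integral_mono[OF int int max_sum_mono_Suc] by simp
    also have "\<dots> = (LINT x|M. max_sum T (Suc N) \<phi> x - max_sum T N \<phi> (T x))"
      using measure_preserving_integral[OF T int, of N] int
      by (simp add: Bochner_Integration.integral_diff del: max_sum.simps)
    also have "\<dots> \<le> (LINT x:?E (Suc N)|M. \<phi> x)"
      unfolding set_lebesgue_integral_def
    proof (rule integral_mono)
      show "integrable M (\<lambda>x. max_sum T (Suc N) \<phi> x - max_sum T N \<phi> (T x))"
        by (intro Bochner_Integration.integrable_diff int measure_preserving_integral(1)[OF T])
      show "integrable M (\<lambda>x. indicat_real (?E (Suc N)) x *\<^sub>R \<phi> x)"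
        using \<phi> E by (intro integrable_mult_indicator)
      fix x assume "x \<in> space M"
      moreover have "0 \<le> max_sum T N \<phi> (T x)" by (cases N) auto
      ultimately show "max_sum T (Suc N) \<phi> x - max_sum T N \<phi> (T x)
          \<le> indicat_real (?E (Suc N)) x *\<^sub>R \<phi> x"
        by (auto simp: indicator_def)
    qed
    finally show ?thesis .
  qed
  have inc: "incseq (\<lambda>N. ?E (Suc N))"
    by (rule incseq_SucI) (use max_sum_mono_Suc[of T _ \<phi>] in \<open>fastforce intro: less_le_trans simp del: max_sum.simps\<close>)
  have un: "(\<Union>N. ?E (Suc N)) = {x \<in> space M. \<exists>n. birkhoff_sum T n \<phi> x > 0}" (is "_ = ?E'")
  proof (intro equalityI subsetI)
    fix x assume "x \<in> (\<Union>N. ?E (Suc N))"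
    then obtain N where N: "x \<in> space M" "max_sum T (Suc N) \<phi> x > 0" by blast
    obtain n where "max_sum T (Suc N) \<phi> x = birkhoff_sum T n \<phi> x"
      using max_sum_attained[of T "Suc N" \<phi> x] by blast
    with N show "x \<in> ?E'" by (auto simp del: max_sum.simps)
  next
    fix x assume "x \<in> ?E'"
    then obtain n where n: "x \<in> space M" "birkhoff_sum T n \<phi> x > 0" by blast
    then have "max_sum T (Suc n) \<phi> x > 0"
      using birkhoff_sum_le_max_sum[of T n \<phi> x] max_sum_mono_Suc[of T n \<phi> x] by linarith
    with n show "x \<in> (\<Union>N. ?E (Suc N))" by blast
  qed
  have "(\<lambda>N. LINT x:?E (Suc N)|M. \<phi> x) \<longlonglongrightarrow> (LINT x:(\<Union>N. ?E (Suc N))|M. \<phi> x)"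
    using E by (intro set_integral_cont_up inc set_integrable_if_integrable \<phi> sets.countable_UN)
      (auto simp del: max_sum.simps)
  then have "0 \<le> (LINT x:(\<Union>N. ?E (Suc N))|M. \<phi> x)"
    using nonneg by (intro LIMSEQ_le_const) auto
  then show ?thesis unfolding un .
qed

text \<open>Replace \<open>\<phi>\<close> by \<open>0\<close> off \<open>A\<close>. By invariance this leaves the Birkhoff sums on \<open>A\<close> unchanged, and they
  vanish off \<open>A\<close>; so for the cut-off function the maximal inequality integrates over \<open>A\<close>, up to a
  null set.\<close>

lemma integral_nonneg_on_invariant_set:
  assumes T: "measure_preserving_map M T" and \<phi>: "integrable M \<phi>"
    and A: "A \<in> sets M" "invariant_set M T A"
    and pos: "AE x in M. x \<in> A \<longrightarrow> (\<exists>n. birkhoff_sum T n \<phi> x > 0)"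
  shows "0 \<le> (LINT x:A|M. \<phi> x)"
proof -
  let ?\<psi> = "\<lambda>x. indicat_real A x * \<phi> x"
  have S: "birkhoff_sum T n ?\<psi> x = indicat_real A x * birkhoff_sum T n \<phi> x" if "x \<in> space M" for n x
    using invariant_set_orbit[OF A(2) measure_preserving_measurable[OF T] that]
    by (intro birkhoff_sum_invariant_mult) (simp add: indicator_def)
  have \<psi>: "integrable M ?\<psi>"
    using integrable_mult_indicator[OF A(1) \<phi>] by simp
  note [measurable] = A(1) borel_measurable_integrable[OF \<phi>]
    birkhoff_sum_measurable[OF measure_preserving_measurable[OF T] borel_measurable_integrable[OF \<psi>]]
  have "0 \<le> (LINT x:{x \<in> space M. \<exists>n. birkhoff_sum T n ?\<psi> x > 0}|M. ?\<psi> x)"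
    by (rule maximal_ergodic_inequality[OF T \<psi>])
  also have "\<dots> = (LINT x:A|M. \<phi> x)"
    unfolding set_lebesgue_integral_def
  proof (rule integral_cong_AE)
    show "AE x in M. indicat_real {x \<in> space M. \<exists>n. 0 < birkhoff_sum T n ?\<psi> x} x *\<^sub>R ?\<psi> x
       = indicat_real A x *\<^sub>R \<phi> x"
      using pos AE_space
    proof eventually_elim
      case (elim x)
      then show ?case by (cases "x \<in> A") (auto simp: S)
    qed
  qed measurable
  finally show ?thesis .
qed

section \<open>Recurrence\<close>

text \<open>No orbit that starts at a point of \<open>A\<close> that never returns to \<open>A\<close> meets another such point, so
  these points form a wandering set.\<close>

lemma conservative_recurrence:
  assumes T: "measure_preserving_map M T" and cons: "conservative_map M T"
    and [measurable]: "A \<in> sets M"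
  shows "AE x in M. x \<in> A \<longrightarrow> (\<exists>n\<ge>1. (T ^^ n) x \<in> A)"
proof -
  have [measurable]: "(T ^^ k) \<in> measurable M M" for k
    using measure_preserving_measurable[OF T] by (rule measurable_compose_n)
  define W where "W = {x \<in> space M. x \<in> A \<and> \<not> (\<exists>n\<ge>1. (T ^^ n) x \<in> A)}"
  have W: "W \<in> sets M" unfolding W_def by measurable
  have "W \<inter> ((T ^^ n) -` W \<inter> space M) = {}" if "n \<ge> 1" for n
    using that by (auto simp: W_def)
  then have "emeasure M W = 0"
    using cons W unfolding conservative_map_def by (metis emeasure_empty less_irrefl not_gr_zero)
  then show ?thesis
    by (intro AE_I[of _ _ W]) (use W in \<open>auto simp: W_def\<close>)
qed

text \<open>Each visit to a set where \<open>g \<ge> c\<close> adds at least \<open>c\<close>, and every visit is followed by another.\<close>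

lemma birkhoff_sum_ge_visits:
  fixes g :: "'a \<Rightarrow> real"
  assumes nonneg: "\<And>k. 0 \<le> g ((T ^^ k) x)"
    and start: "(T ^^ j) x \<in> A" and large: "\<And>k. (T ^^ k) x \<in> A \<Longrightarrow> g ((T ^^ k) x) \<ge> c"
    and ret: "\<And>k. (T ^^ k) x \<in> A \<Longrightarrow> \<exists>n\<ge>1. (T ^^ (n + k)) x \<in> A"
  shows "\<exists>n. (T ^^ n) x \<in> A \<and> birkhoff_sum T n g x \<ge> real m * c"
proof (induction m)
  case 0
  show ?case using start nonneg by (auto simp: birkhoff_sum_def intro!: exI[of _ j] sum_nonneg)
next
  case (Suc m)
  then obtain n where n: "(T ^^ n) x \<in> A" "birkhoff_sum T n g x \<ge> real m * c" by blast
  obtain l where l: "l \<ge> 1" "(T ^^ (l + n)) x \<in> A" using ret[OF n(1)] by blast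
  have "birkhoff_sum T (Suc n) g x \<le> birkhoff_sum T (l + n) g x"
    unfolding birkhoff_sum_def using l nonneg by (intro sum_mono2) auto
  moreover have "birkhoff_sum T (Suc n) g x \<ge> real (Suc m) * c"
    using n(2) large[OF n(1)] by (simp add: birkhoff_sum_def algebra_simps)
  ultimately show ?case using l(2) by (intro exI[of _ "l + n"]) linarith
qed

text \<open>Almost every \<open>x\<close> lies in \<open>{g \<ge> 1 / (i + 1)}\<close> for some \<open>i\<close>, and recurrence at every point of the orbit
  brings it back infinitely often.\<close>

lemma birkhoff_sum_at_top:
  fixes g :: "'a \<Rightarrow> real"
  assumes T: "measure_preserving_map M T" and cons: "conservative_map M T"
    and [measurable]: "g \<in> borel_measurable M" and pos: "AE x in M. g x > 0"
  shows "AE x in M. filterlim (\<lambda>n. birkhoff_sum T n g x) at_top sequentially"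
proof -
  define A where "A i = {x \<in> space M. g x \<ge> inverse (real (Suc i))}" for i
  have A: "A i \<in> sets M" for i unfolding A_def by measurable
  have "AE x in M. \<forall>k. (T ^^ k) x \<in> A i \<longrightarrow> (\<exists>n\<ge>1. (T ^^ n) ((T ^^ k) x) \<in> A i)" for i
    by (rule measure_preserving_AE_orbit[OF T conservative_recurrence[OF T cons A]])
  then have "AE x in M. \<forall>i k. (T ^^ k) x \<in> A i \<longrightarrow> (\<exists>n\<ge>1. (T ^^ n) ((T ^^ k) x) \<in> A i)"
    by (simp add: AE_all_countable)
  with measure_preserving_AE_orbit[OF T pos] AE_space
  show ?thesis
  proof eventually_elim
    case (elim x)
    have nonneg: "0 \<le> g ((T ^^ k) x)" for k using elim(1) by (simp add: less_imp_le)
    have "0 < g x" using elim(1)[rule_format, of 0] by simp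
    then obtain i where "inverse (real (Suc i)) < g x" using reals_Archimedean by blast
    then have start: "(T ^^ 0) x \<in> A i" using elim(2) by (simp add: A_def)
    have unb: "\<exists>n. birkhoff_sum T n g x \<ge> K" for K
    proof -
      obtain m :: nat where m: "K * real (Suc i) \<le> real m" using real_arch_simple by blast
      have "\<exists>n. (T ^^ n) x \<in> A i \<and> birkhoff_sum T n g x \<ge> real m * inverse (real (Suc i))"
      proof (rule birkhoff_sum_ge_visits[where j = 0])
        show "0 \<le> g ((T ^^ k) x)" for k by (rule nonneg)
        show "(T ^^ 0) x \<in> A i" by (rule start)
        show "g ((T ^^ k) x) \<ge> inverse (real (Suc i))" if "(T ^^ k) x \<in> A i" for k
          using that by (simp add: A_def)
        show "\<exists>n\<ge>1. (T ^^ (n + k)) x \<in> A i" if "(T ^^ k) x \<in> A i" for k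
          using elim(3) that by (auto simp: funpow_add)
      qed
      then obtain n where "birkhoff_sum T n g x \<ge> real m * inverse (real (Suc i))" by blast
      moreover have "K \<le> real m * inverse (real (Suc i))" using m by (simp add: field_simps)
      ultimately show ?thesis by (intro exI[of _ n]) linarith
    qed
    have mono: "birkhoff_sum T n g x \<le> birkhoff_sum T n' g x" if "n \<le> n'" for n n'
      unfolding birkhoff_sum_def using that nonneg by (intro sum_mono2) auto
    show ?case unfolding filterlim_at_top eventually_sequentially
      using unb mono by (meson order_trans)
  qed
qed

section \<open>Convergence of the ratios\<close>

lemma eventually_ratio_less:
  fixes s t :: "nat \<Rightarrow> real"
  assumes t: "filterlim t at_top sequentially" and bd: "\<And>n. s n - c * t n \<le> K" and "c < d"
  shows "\<forall>\<^sub>F n in sequentially. s n / t n < d"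
proof -
  have "\<forall>\<^sub>F n in sequentially. t n > max 0 (K / (d - c))"
    using t unfolding filterlim_at_top_dense by blast
  then show ?thesis
  proof eventually_elim
    case (elim n)
    then have "t n > 0" "K < (d - c) * t n" using \<open>c < d\<close> by (auto simp: field_simps)
    moreover have "s n \<le> c * t n + K" using bd[of n] by simp
    ultimately show ?case by (simp add: field_simps)
  qed
qed

text \<open>A bound on \<open>s - b t\<close> forces the upper limit of \<open>s / t\<close> to be at most \<open>b\<close>, and a bound on \<open>a t - s\<close>
  forces the lower limit to be at least \<open>a\<close>, because \<open>t\<close> tends to infinity. The limit is the
  infimum of the \<open>b\<close> for which \<open>s - b t\<close> is bounded above. The alternative for \<open>a < b\<close> is only required for
  rational numbers: it will be known almost everywhere for each single pair, and almost everywhere for all pairs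
  at once only if these are countably many.\<close>

lemma ratio_convergent:
  fixes s t :: "nat \<Rightarrow> real"
  assumes t: "filterlim t at_top sequentially"
    and above: "bdd_above (range (\<lambda>n. s n - b0 * t n))"
    and below: "bdd_above (range (\<lambda>n. a0 * t n - s n))"
    and cross: "\<And>a b. a \<in> \<rat> \<Longrightarrow> b \<in> \<rat> \<Longrightarrow> a < b \<Longrightarrow>
      bdd_above (range (\<lambda>n. s n - b * t n)) \<or> bdd_above (range (\<lambda>n. a * t n - s n))"
  shows "convergent (\<lambda>n. s n / t n)"
proof -
  let ?B = "{b. bdd_above (range (\<lambda>n. s n - b * t n))}"
  have upper: "\<forall>\<^sub>F n in sequentially. s n / t n < d" if "b \<in> ?B" "b < d" for b d
    using that eventually_ratio_less[OF t] by (auto simp: bdd_above_def)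
  have lower: "\<forall>\<^sub>F n in sequentially. s n / t n > d"
    if "bdd_above (range (\<lambda>n. a * t n - s n))" "d < a" for a d
  proof -
    from that obtain K where "\<And>n. - s n - (- a) * t n \<le> K" by (auto simp: bdd_above_def)
    from eventually_ratio_less[OF t this, of "- d"] that show ?thesis by simp
  qed
  have "a0 \<le> b" if "b \<in> ?B" for b
  proof (rule ccontr)
    assume "\<not> a0 \<le> b"
    then have "b < (a0 + b) / 2" "(a0 + b) / 2 < a0" by auto
    then have "\<forall>\<^sub>F n in sequentially. s n / t n < (a0 + b) / 2 \<and> s n / t n > (a0 + b) / 2"
      using eventually_conj upper[OF that] lower[OF below] by blast
    then show False by (auto dest: eventually_happens)
  qed
  then have bdd: "bdd_below ?B" by (intro bdd_belowI[of _ a0])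
  have "(\<lambda>n. s n / t n) \<longlonglongrightarrow> Inf ?B"
  proof (rule order_tendstoI)
    fix d assume "Inf ?B < d"
    moreover have "?B \<noteq> {}" using above by blast
    ultimately obtain b where "b \<in> ?B" "b < d" using cInf_lessD[of ?B d] by blast
    then show "\<forall>\<^sub>F n in sequentially. s n / t n < d" by (rule upper)
  next
    fix d assume "d < Inf ?B"
    then obtain a where a: "a \<in> \<rat>" "d < a" "a < Inf ?B" using Rats_dense_in_real by blast
    then obtain b where b: "b \<in> \<rat>" "a < b" "b < Inf ?B" using Rats_dense_in_real by blast
    have "b \<notin> ?B" using b(3) cInf_lower[OF _ bdd] by force
    then have "bdd_above (range (\<lambda>n. a * t n - s n))" using cross[OF a(1) b(1,2)] by simp
    then show "\<forall>\<^sub>F n in sequentially. d < s n / t n" using a(2) by (rule lower)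
  qed
  then show ?thesis by (auto simp: convergent_def)
qed

text \<open>The ratios along the orbit of \<open>T x\<close> arise from those of \<open>x\<close> in this way, with \<open>c = f x\<close> and \<open>d = g x\<close>.\<close>

lemma ratio_tendsto_shift:
  fixes s t :: "nat \<Rightarrow> real"
  assumes t: "filterlim t at_top sequentially" and lim: "(\<lambda>n. s n / t n) \<longlonglongrightarrow> l"
  shows "(\<lambda>n. (s (Suc n) - c) / (t (Suc n) - d)) \<longlonglongrightarrow> l"
proof -
  have t': "filterlim (\<lambda>n. t (Suc n)) at_top sequentially"
    using t filterlim_sequentially_Suc by blast
  have small: "(\<lambda>n. k / t (Suc n)) \<longlonglongrightarrow> 0" for k
    by (rule real_tendsto_divide_at_top[OF tendsto_const t'])
  \<comment> \<open>Divide numerator and denominator by \<open>t (Suc n)\<close>.\<close>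
  have "(\<lambda>n. (s (Suc n) / t (Suc n) - c / t (Suc n)) / (1 - d / t (Suc n))) \<longlonglongrightarrow> (l - 0) / (1 - 0)"
    by (intro tendsto_intros small LIMSEQ_Suc[OF lim]) simp
  moreover have "\<forall>\<^sub>F n in sequentially. t (Suc n) > 0"
    using t' by (simp add: filterlim_at_top_dense)
  then have "\<forall>\<^sub>F n in sequentially. (s (Suc n) / t (Suc n) - c / t (Suc n)) / (1 - d / t (Suc n))
      = (s (Suc n) - c) / (t (Suc n) - d)"
  proof eventually_elim
    case (elim n)
    then have "s (Suc n) / t (Suc n) - c / t (Suc n) = (s (Suc n) - c) / t (Suc n)"
      "1 - d / t (Suc n) = (t (Suc n) - d) / t (Suc n)" by (simp_all add: field_simps)
    with elim show ?case by simp
  qed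
  ultimately show ?thesis using Lim_transform_eventually[of _ "(l - 0) / (1 - 0)"] by simp
qed

lemma AE_notin_if_integral_nonpos:
  fixes g :: "'a \<Rightarrow> real"
  assumes g: "integrable M g" "AE x in M. g x > 0" and A: "A \<in> sets M"
    and le: "(LINT x:A|M. g x) \<le> 0"
  shows "AE x in M. x \<notin> A"
proof -
  have nonneg: "AE x in M. 0 \<le> indicat_real A x *\<^sub>R g x"
    using g(2) by eventually_elim simp
  then have "(LINT x:A|M. g x) = 0"
    using le integral_nonneg_AE[OF nonneg] unfolding set_lebesgue_integral_def by simp
  then have "AE x in M. indicat_real A x *\<^sub>R g x = 0"
    using integral_nonneg_eq_0_iff_AE[OF integrable_mult_indicator[OF A g(1)] nonneg]
    unfolding set_lebesgue_integral_def by simp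
  with g(2) show ?thesis by eventually_elim (auto simp: indicator_def)
qed

lemma integral_nonneg_on_unbounded_sums:
  assumes T: "measure_preserving_map M T" and \<phi>: "integrable M \<phi>"
    and A: "A \<in> sets M" "invariant_set M T A" "A \<subseteq> unbounded_sums M T \<phi>"
  shows "0 \<le> (LINT x:A|M. \<phi> x)"
  using A unbounded_sumsD[of _ M T \<phi> 0]
  by (intro integral_nonneg_on_invariant_set[OF T \<phi>] AE_I2) auto

lemma not_unbounded_sums:
  assumes "x \<in> space M" "x \<notin> unbounded_sums M T \<phi>"
  shows "bdd_above (range (\<lambda>n. birkhoff_sum T n \<phi> x))"
  using assms by (force simp: unbounded_sums_def not_less bdd_above_def)

text \<open>On this invariant set both \<open>f - b g\<close> and \<open>a g - f\<close> have nonnegative integral, so their sum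
  \<open>(a - b) g\<close> does too, while \<open>g > 0\<close> and \<open>a < b\<close>.\<close>

lemma AE_not_oscillating:
  assumes T: "measure_preserving_map M T" and f: "integrable M f"
    and g: "integrable M g" "AE x in M. g x > 0" and ab: "(a::real) < b"
  shows "AE x in M. x \<notin> unbounded_sums M T (\<lambda>x. f x - b * g x) \<inter> unbounded_sums M T (\<lambda>x. a * g x - f x)"
    (is "AE x in M. x \<notin> ?A")
proof (rule AE_notin_if_integral_nonpos[OF g])
  note Tm = measure_preserving_measurable[OF T]
  show A: "?A \<in> sets M"
    using f g by (intro sets.Int unbounded_sums_sets[OF Tm]) auto
  have inv: "invariant_set M T ?A"
    by (intro invariant_set_Int unbounded_sums_invariant[OF Tm])
  have fA: "set_integrable M ?A f" and gA: "set_integrable M ?A g"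
    using f g A by (auto intro!: set_integrable_if_integrable)
  have "0 \<le> (LINT x:?A|M. f x - b * g x)" "0 \<le> (LINT x:?A|M. a * g x - f x)"
    using f g A inv by (auto intro!: integral_nonneg_on_unbounded_sums[OF T])
  then have "0 \<le> (a - b) * (LINT x:?A|M. g x)"
    using fA gA by (simp add: set_integral_diff algebra_simps)
  then show "(LINT x:?A|M. g x) \<le> 0" using ab by (simp add: zero_le_mult_iff)
qed

text \<open>On this invariant set \<open>\<integral> f \<ge> k \<integral> g\<close> for every \<open>k\<close>, which is impossible unless \<open>\<integral> g = 0\<close>.\<close>

lemma AE_ratio_bounded_above:
  assumes T: "measure_preserving_map M T" and f: "integrable M f"
    and g: "integrable M g" "AE x in M. g x > 0"
  shows "AE x in M. x \<notin> (\<Inter>k::nat. unbounded_sums M T (\<lambda>x. f x - real k * g x))"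
    (is "AE x in M. x \<notin> ?A")
proof (rule AE_notin_if_integral_nonpos[OF g])
  note Tm = measure_preserving_measurable[OF T]
  show A: "?A \<in> sets M"
    using f g by (intro sets.countable_INT' unbounded_sums_sets[OF Tm]) (auto intro!: unbounded_sums_sets[OF Tm])
  have inv: "invariant_set M T ?A"
    by (intro invariant_set_INT unbounded_sums_invariant[OF Tm])
  have fA: "set_integrable M ?A f" and gA: "set_integrable M ?A g"
    using f g A by (auto intro!: set_integrable_if_integrable)
  have le: "real k * (LINT x:?A|M. g x) \<le> (LINT x:?A|M. f x)" for k
  proof -
    have "0 \<le> (LINT x:?A|M. f x - real k * g x)"
      using f g A inv by (intro integral_nonneg_on_unbounded_sums[OF T]) auto
    then show ?thesis using fA gA by (simp add: set_integral_diff)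
  qed
  show "(LINT x:?A|M. g x) \<le> 0"
  proof (rule ccontr)
    assume "\<not> (LINT x:?A|M. g x) \<le> 0"
    then obtain k :: nat where "(LINT x:?A|M. f x) < real k * (LINT x:?A|M. g x)"
      using ex_less_of_nat_mult[of "LINT x:?A|M. g x"] by auto
    with le[of k] show False by simp
  qed
qed

lemma AE_ratio_convergent:
  assumes T: "measure_preserving_map M T" and f: "integrable M f"
    and g: "integrable M g" "AE x in M. g x > 0"
    and top: "AE x in M. filterlim (\<lambda>n. birkhoff_sum T n g x) at_top sequentially"
  shows "AE x in M. convergent (\<lambda>n. birkhoff_sum T n f x / birkhoff_sum T n g x)"
proof -
  let ?U = "\<lambda>b. unbounded_sums M T (\<lambda>x. f x - b * g x)"
  let ?L = "\<lambda>a. unbounded_sums M T (\<lambda>x. a * g x - f x)"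
  have "AE x in M. \<forall>a\<in>\<rat>. \<forall>b\<in>\<rat>. a < b \<longrightarrow> x \<notin> ?U b \<inter> ?L a"
    using AE_not_oscillating[OF T f g]
    by (auto simp: AE_ball_countable[OF countable_rat] simp del: Int_iff)
  moreover have "AE x in M. \<exists>k::nat. x \<notin> ?U (real k)"
    using AE_ratio_bounded_above[OF T f g] by simp
  \<comment> \<open>The lower bound is the upper bound for \<open>- f\<close>.\<close>
  moreover have "AE x in M. \<exists>k::nat. x \<notin> ?L (- real k)"
  proof -
    have "(\<lambda>x. - f x - real k * g x) = (\<lambda>x. - real k * g x - f x)" for k by (simp add: fun_eq_iff)
    with AE_ratio_bounded_above[OF T integrable_minus[OF f] g] show ?thesis by simp
  qed
  ultimately show ?thesis using top AE_space
  proof eventually_elim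
    case (elim x)
    have U: "bdd_above (range (\<lambda>n. birkhoff_sum T n f x - b * birkhoff_sum T n g x))"
      if "x \<notin> ?U b" for b
      using not_unbounded_sums[OF elim(5) that] by (simp add: birkhoff_sum_diff birkhoff_sum_cmult)
    have L: "bdd_above (range (\<lambda>n. a * birkhoff_sum T n g x - birkhoff_sum T n f x))"
      if "x \<notin> ?L a" for a
      using not_unbounded_sums[OF elim(5) that] by (simp add: birkhoff_sum_diff birkhoff_sum_cmult)
    obtain k l :: nat where kl: "x \<notin> ?U (real k)" "x \<notin> ?L (- real l)" using elim by blast
    show ?case
    proof (rule ratio_convergent[OF elim(4) U[OF kl(1)] L[OF kl(2)]])
      fix a b :: real assume "a \<in> \<rat>" "b \<in> \<rat>" "a < b"
      then have "x \<notin> ?U b \<or> x \<notin> ?L a" using elim(1) by blast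
      then show "bdd_above (range (\<lambda>n. birkhoff_sum T n f x - b * birkhoff_sum T n g x)) \<or>
          bdd_above (range (\<lambda>n. a * birkhoff_sum T n g x - birkhoff_sum T n f x))"
        using U[of b] L[of a] by (rule disj_forward)
    qed
  qed
qed

section \<open>The integral identity\<close>

text \<open>The hypothesis says that the lower limit of \<open>S n \<phi> / S n g\<close> is nonnegative. For every \<open>e > 0\<close> it makes some
  Birkhoff sum of \<open>\<phi> + e g\<close> positive, so \<open>\<phi> + e g\<close> has nonnegative integral; then \<open>e\<close> tends to \<open>0\<close>.\<close>

lemma integral_nonneg_if_ratio_nonneg:
  assumes T: "measure_preserving_map M T" and \<phi>: "integrable M \<phi>" and g: "integrable M g"
    and top: "AE x in M. filterlim (\<lambda>n. birkhoff_sum T n g x) at_top sequentially"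
    and A: "A \<in> sets M" "invariant_set M T A"
    and ratio: "AE x in M. \<forall>e>0. \<forall>\<^sub>F n in sequentially. birkhoff_sum T n \<phi> x / birkhoff_sum T n g x > - e"
  shows "0 \<le> (LINT x:A|M. \<phi> x)"
proof -
  have sA: "set_integrable M A \<phi>" "set_integrable M A g"
    using \<phi> g A by (auto intro!: set_integrable_if_integrable)
  have *: "0 \<le> (LINT x:A|M. \<phi> x) + e * (LINT x:A|M. g x)" if "e > 0" for e
  proof -
    have "0 \<le> (LINT x:A|M. \<phi> x + e * g x)"
    proof (rule integral_nonneg_on_invariant_set[OF T _ A])
      show "integrable M (\<lambda>x. \<phi> x + e * g x)" using \<phi> g by simp
      show "AE x in M. x \<in> A \<longrightarrow> (\<exists>n. birkhoff_sum T n (\<lambda>x. \<phi> x + e * g x) x > 0)"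
        using ratio top
      proof eventually_elim
        case (elim x)
        have "\<forall>\<^sub>F n in sequentially. birkhoff_sum T n g x > 0"
          using elim(2) by (simp add: filterlim_at_top_dense)
        then have "\<forall>\<^sub>F n in sequentially. birkhoff_sum T n g x > 0 \<and>
            birkhoff_sum T n \<phi> x / birkhoff_sum T n g x > - e"
          using elim(1) \<open>e > 0\<close> by (simp add: eventually_conj)
        then obtain n where "birkhoff_sum T n g x > 0"
            "birkhoff_sum T n \<phi> x / birkhoff_sum T n g x > - e"
          by (auto dest: eventually_happens)
        then have "birkhoff_sum T n \<phi> x + e * birkhoff_sum T n g x > 0"
          by (simp add: field_simps)
        then show ?case by (auto simp: birkhoff_sum_add birkhoff_sum_cmult)
      qed
    qed
    then show ?thesis using sA by (simp add: set_integral_add)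
  qed
  have "((\<lambda>e. (LINT x:A|M. \<phi> x) + e * (LINT x:A|M. g x)) \<longlongrightarrow> (LINT x:A|M. \<phi> x) + 0 * (LINT x:A|M. g x)) (at_right 0)"
    by (intro tendsto_intros)
  moreover have "\<forall>\<^sub>F e in at_right 0. 0 \<le> (LINT x:A|M. \<phi> x) + e * (LINT x:A|M. g x)"
    using * by (rule eventually_mono[OF eventually_at_right_less])
  ultimately have "0 \<le> (LINT x:A|M. \<phi> x) + 0 * (LINT x:A|M. g x)"
    by (rule tendsto_lowerbound) simp
  then show ?thesis by simp
qed

lemma invariant_function_orbit:
  assumes T: "measure_preserving_map M T" and h: "AE x in M. h (T x) = h x"
  shows "AE x in M. \<forall>k. h ((T ^^ k) x) = h x"
  using measure_preserving_AE_orbit[OF T h]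
proof eventually_elim
  case (elim x)
  show ?case
  proof
    fix k show "h ((T ^^ k) x) = h x" by (induction k) (use elim in auto)
  qed
qed

text \<open>The truncation \<open>u = min \<bar>h\<bar> K\<close> is bounded and invariant, so \<open>u g\<close> is integrable and
  \<open>S n (\<bar>f\<bar> - u g) / S n g \<ge> \<bar>S n f / S n g\<bar> - u\<close>, whose limit \<open>\<bar>h\<bar> - u\<close> is nonnegative. Hence
  \<open>\<integral> u g \<le> \<integral> \<bar>f\<bar>\<close> uniformly in \<open>K\<close>, and monotone convergence applies.\<close>

lemma ratio_limit_integrable:
  assumes T: "measure_preserving_map M T" and f: "integrable M f"
    and g: "integrable M g" "AE x in M. g x > 0"
    and top: "AE x in M. filterlim (\<lambda>n. birkhoff_sum T n g x) at_top sequentially"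
    and h [measurable]: "h \<in> borel_measurable M"
    and lim: "AE x in M. (\<lambda>n. birkhoff_sum T n f x / birkhoff_sum T n g x) \<longlonglongrightarrow> h x"
    and inv: "AE x in M. h (T x) = h x"
  shows "integrable M (\<lambda>x. h x * g x)"
proof -
  note [measurable] = borel_measurable_integrable[OF f] borel_measurable_integrable[OF g(1)]
  let ?u = "\<lambda>K x. min \<bar>h x\<bar> (real K)"
  have u: "integrable M (\<lambda>x. ?u K x * g x)" for K
    by (rule Bochner_Integration.integrable_bound[of M "\<lambda>x. real K * g x"])
      (use g(1) in \<open>auto simp: abs_mult intro!: mult_right_mono\<close>)
  have le: "(LINT x|M. ?u K x * g x) \<le> (LINT x|M. \<bar>f x\<bar>)" for K
  proof -
    have "0 \<le> (LINT x:space M|M. \<bar>f x\<bar> - ?u K x * g x)"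
    proof (rule integral_nonneg_if_ratio_nonneg[OF T _ g(1) top])
      show "invariant_set M T (space M)"
        using measurable_space[OF measure_preserving_measurable[OF T]] by (auto simp: invariant_set_def)
      show "integrable M (\<lambda>x. \<bar>f x\<bar> - ?u K x * g x)" using f u by simp
      show "AE x in M. \<forall>e>0. \<forall>\<^sub>F n in sequentially.
          birkhoff_sum T n (\<lambda>x. \<bar>f x\<bar> - ?u K x * g x) x / birkhoff_sum T n g x > - e"
        using lim top invariant_function_orbit[OF T inv]
      proof (eventually_elim, intro allI impI)
        fix x and e :: real
        assume x: "(\<lambda>n. birkhoff_sum T n f x / birkhoff_sum T n g x) \<longlonglongrightarrow> h x"
          "filterlim (\<lambda>n. birkhoff_sum T n g x) at_top sequentially"
          "\<forall>k. h ((T ^^ k) x) = h x" and e: "0 < e"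
        have "\<forall>\<^sub>F n in sequentially. birkhoff_sum T n g x > 0"
          using x(2) by (simp add: filterlim_at_top_dense)
        moreover have "\<forall>\<^sub>F n in sequentially. \<bar>birkhoff_sum T n f x / birkhoff_sum T n g x\<bar> > \<bar>h x\<bar> - e"
          using tendsto_rabs[OF x(1)] e by (intro order_tendstoD) auto
        ultimately show "\<forall>\<^sub>F n in sequentially.
          birkhoff_sum T n (\<lambda>x. \<bar>f x\<bar> - ?u K x * g x) x / birkhoff_sum T n g x > - e"
        proof eventually_elim
          case (elim n)
          have "birkhoff_sum T n (\<lambda>x. \<bar>f x\<bar> - ?u K x * g x) x
              = birkhoff_sum T n (\<lambda>x. \<bar>f x\<bar>) x - ?u K x * birkhoff_sum T n g x"
            using x(3) by (simp only: birkhoff_sum_diff birkhoff_sum_invariant_mult)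
          then have "birkhoff_sum T n (\<lambda>x. \<bar>f x\<bar> - ?u K x * g x) x / birkhoff_sum T n g x
              = birkhoff_sum T n (\<lambda>x. \<bar>f x\<bar>) x / birkhoff_sum T n g x - ?u K x"
            using elim(1) by (simp add: diff_divide_distrib)
          moreover have "\<bar>birkhoff_sum T n f x / birkhoff_sum T n g x\<bar>
              \<le> birkhoff_sum T n (\<lambda>x. \<bar>f x\<bar>) x / birkhoff_sum T n g x"
            using elim(1) abs_birkhoff_sum_le[of T n f x] by (simp add: divide_right_mono)
          ultimately show ?case using elim(2) by linarith
        qed
      qed
    qed simp
    then show ?thesis using f u by (simp add: set_integral_space)
  qed
  have mono: "AE x in M. mono (\<lambda>K. ?u K x * g x)"
    using g(2) by eventually_elim (auto intro!: monoI mult_right_mono)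
  have "incseq (\<lambda>K. LINT x|M. ?u K x * g x)"
    by (intro incseq_SucI integral_mono_AE u) (use g(2) in \<open>eventually_elim, auto intro!: mult_right_mono\<close>)
  then obtain l where l: "(\<lambda>K. LINT x|M. ?u K x * g x) \<longlonglongrightarrow> l"
    using incseq_convergent[of _ "LINT x|M. \<bar>f x\<bar>"] le by blast
  have "AE x in M. (\<lambda>K. ?u K x * g x) \<longlonglongrightarrow> \<bar>h x\<bar> * g x"
  proof (rule AE_I2, rule tendsto_eventually)
    fix x
    obtain k :: nat where "\<bar>h x\<bar> \<le> real k" using real_arch_simple by blast
    then show "\<forall>\<^sub>F K in sequentially. ?u K x * g x = \<bar>h x\<bar> * g x"
      unfolding eventually_sequentially by (intro exI[of _ k]) (auto simp: min_def)
  qed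
  then have "integrable M (\<lambda>x. \<bar>h x\<bar> * g x)"
    by (rule integrable_monotone_convergence[OF u mono _ l]) measurable
  then show ?thesis
    by (rule Bochner_Integration.integrable_bound) (auto simp: abs_mult)
qed

theorem theorem1p2:
  fixes M :: "'a measure" and T :: "'a \<Rightarrow> 'a" and f g :: "'a \<Rightarrow> real"
  assumes "sigma_finite_measure M"
    and "measure_preserving_map M T"
    and "conservative_map M T"
    and "integrable M f"
    and "integrable M g"
    and "AE x in M. g x > 0"
  shows "\<exists>h :: 'a \<Rightarrow> real.
    h \<in> borel_measurable M \<and>
    (AE x in M. (\<lambda>n. birkhoff_sum T n f x / birkhoff_sum T n g x) \<longlonglongrightarrow> h x) \<and>
    (AE x in M. h (T x) = h x) \<and>
    integrable M (\<lambda>x. h x * g x) \<and>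
    (\<forall>A\<in>sets M. invariant_set M T A \<longrightarrow>
       (LINT x:A|M. f x) = (LINT x:A|M. h x * g x))"
proof -
  note T = assms(2) and f = assms(4) and g = assms(5,6)
  note fm [measurable] = borel_measurable_integrable[OF f]
  note gm [measurable] = borel_measurable_integrable[OF g(1)]
  note Tm = measure_preserving_measurable[OF T]
  note [measurable] = birkhoff_sum_measurable[OF Tm fm] birkhoff_sum_measurable[OF Tm gm]
  define h where "h = (\<lambda>x. lim (\<lambda>n. birkhoff_sum T n f x / birkhoff_sum T n g x))"
  have h [measurable]: "h \<in> borel_measurable M"
    unfolding h_def by (rule borel_measurable_lim_metric) measurable
  have top: "AE x in M. filterlim (\<lambda>n. birkhoff_sum T n g x) at_top sequentially"
    by (rule birkhoff_sum_at_top[OF T assms(3) gm g(2)])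
  have lim: "AE x in M. (\<lambda>n. birkhoff_sum T n f x / birkhoff_sum T n g x) \<longlonglongrightarrow> h x"
    using AE_ratio_convergent[OF T f g top] by (simp add: h_def convergent_LIMSEQ_iff)
  have inv: "AE x in M. h (T x) = h x"
    using lim top
  proof eventually_elim
    case (elim x)
    from ratio_tendsto_shift[OF elim(2,1), of "f x" "g x"]
    show ?case by (simp add: birkhoff_sum_Suc h_def limI)
  qed
  have hg: "integrable M (\<lambda>x. h x * g x)"
    by (rule ratio_limit_integrable[OF T f g top h lim inv])
  have "AE x in M. (\<lambda>n. birkhoff_sum T n (\<lambda>x. f x - h x * g x) x / birkhoff_sum T n g x) \<longlonglongrightarrow> 0"
    using lim top invariant_function_orbit[OF T inv]
  proof eventually_elim
    case (elim x)
    have "\<forall>\<^sub>F n in sequentially. birkhoff_sum T n g x > 0"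
      using elim(2) by (simp add: filterlim_at_top_dense)
    then have "\<forall>\<^sub>F n in sequentially. birkhoff_sum T n f x / birkhoff_sum T n g x - h x
        = birkhoff_sum T n (\<lambda>x. f x - h x * g x) x / birkhoff_sum T n g x"
      by eventually_elim
        (use elim(3) in \<open>simp add: birkhoff_sum_diff birkhoff_sum_invariant_mult[of h] diff_divide_distrib\<close>)
    moreover have "(\<lambda>n. birkhoff_sum T n f x / birkhoff_sum T n g x - h x) \<longlonglongrightarrow> 0"
      using elim(1) by (simp add: LIM_zero)
    ultimately show ?case by (rule Lim_transform_eventually[rotated])
  qed
  \<comment> \<open>The factor \<open>c\<close> will be \<open>1\<close> and \<open>- 1\<close>, giving the two inequalities between the integrals.\<close>
  then have zero: "AE x in M. (\<lambda>n. birkhoff_sum T n (\<lambda>x. c * (f x - h x * g x)) x / birkhoff_sum T n g x) \<longlonglongrightarrow> 0" for c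
  proof eventually_elim
    case (elim x)
    show ?case using tendsto_mult_right_zero[OF elim, of c] by (simp add: birkhoff_sum_cmult)
  qed
  have "(LINT x:A|M. f x) = (LINT x:A|M. h x * g x)" if A: "A \<in> sets M" "invariant_set M T A" for A
  proof -
    have sA: "set_integrable M A f" "set_integrable M A (\<lambda>x. h x * g x)"
      using f hg A by (auto intro!: set_integrable_if_integrable)
    have *: "0 \<le> c * ((LINT x:A|M. f x) - (LINT x:A|M. h x * g x))" for c
    proof -
      have "0 \<le> (LINT x:A|M. c * (f x - h x * g x))"
      proof (rule integral_nonneg_if_ratio_nonneg[OF T _ g(1) top A])
        show "integrable M (\<lambda>x. c * (f x - h x * g x))" using f hg by simp
        show "AE x in M. \<forall>e>0. \<forall>\<^sub>F n in sequentially.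
            birkhoff_sum T n (\<lambda>x. c * (f x - h x * g x)) x / birkhoff_sum T n g x > - e"
          using zero[of c] by eventually_elim (auto intro!: order_tendstoD(1))
      qed
      then show ?thesis using sA by (simp add: set_integral_diff)
    qed
    show ?thesis using *[of 1] *[of "- 1"] by simp
  qed
  with h lim inv hg show ?thesis by blast
qed

end
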